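(* Let $q>3$ be a prime power and let $t>1$ be an integer. Let $s,s'$ be positive integers with $\gcd(s,t)=1=\gcd(s',t)$, and consider the polynomials $f(x)=x^{q^s}$ and $f'(x)=x^{q^{s'}}$ in $\mathbb F_{q^t}[x]$. Then the translation planes $\mathcal A_f$ and $\mathcal A_{f'}$ are isomorphic if and only if $s\equiv\pm s'\pmod t$.
   Context: An $\mathbb F_q$-linearized polynomial in $\mathbb F_{q^t}[x]$ is one of the form $f(x)=\sum_{i=0}^k a_ix^{q^i}$. It is called scattered if for all $y,z\in\mathbb F_{q^t}$ the condition $zf(y)-yf(z)=0$ implies that $y$ and $z$ are linearly dependent over $\mathbb F_q$. The polynomials $x^{q^s}$ with $\gcd(s,t)=1$ are scattered. For a scattered $\mathbb F_q$-linearized polynomial $f(x)$ put $U_f=\{(x,f(x)) : x\in\mathbb F_{q^t}\}$, an $\mathbb F_q$-subspace of $\mathbb F_{q^t}^2$, and $L_f=\{f(x)/x : x\in\mathbb F_{q^t}^*\}\subseteq\mathbb F_{q^t}$. A planar spread of a vector space $\mathbb V$ is a collection $\mathcal B$ of at least three subspaces such that $\mathbb V=V\oplus V'$ for all distinct $V,V'\in\mathcal B$ and every vector of $\mathbb V$ lies in some member of $\mathcal B$. The translation plane $\mathcal A(\mathcal B)$ is the affine plane whose points are the vectors of $\mathbb V$ and whose lines are the cosets $V+w$ ($V\in\mathcal B$, $w\in\mathbb V$). Let $\mathcal B_f$ be the collection consisting of the following subspaces of $\mathbb F_{q^t}^2$: $\langle(1,m)\rangle_{\mathbb F_{q^t}}$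 for $m\in\mathbb F_{q^t}\setminus L_f$; $hU_f=\{hv:v\in U_f\}$ for $h\in\mathbb F_{q^t}^*$; and $\{0\}\times\mathbb F_{q^t}$. This is a planar spread of $\mathbb F_{q^t}^2$ (as an $\mathbb F_q$-vector space), and the translation plane associated with $f$ is $\mathcal A_f=\mathcal A(\mathcal B_f)$. Two planes are isomorphic if there is a bijection between their point sets that maps lines onto lines (in both directions). *)

theory Defs
  imports
    "HOL-Computational_Algebra.Polynomial"
    "HOL-Number_Theory.Cong"
    "HOL-Number_Theory.Prime_Powers"
    "HOL-Library.Cardinality"
    "HOL-Library.Product_Plus"
begin

(* A plane is given by its set of points and its set of lines, a line being the set of
   points on it. *)
type_synonym 'p plane = "'p set \<times> 'p set set"

abbreviation points :: "'p plane \<Rightarrow> 'p set" where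
  "points \<equiv> fst"

abbreviation lines :: "'p plane \<Rightarrow> 'p set set" where
  "lines \<equiv> snd"

definition isomorphic_planes :: "'p plane \<Rightarrow> 'r plane \<Rightarrow> bool" where
  "isomorphic_planes P Q \<longleftrightarrow>
     (\<exists>\<phi>. bij_betw \<phi> (points P) (points Q) \<and>
          (\<forall>l\<in>lines P. \<phi> ` l \<in> lines Q) \<and>
          (\<forall>l\<in>lines Q. inv_into (points P) \<phi> ` l \<in> lines P))"

(* Meaningful when \<B> is a planar spread of the vector space carried by the type 'v. *)
definition translation_plane :: "'v::ab_group_add set set \<Rightarrow> 'v plane" where
  "translation_plane \<B> = (UNIV, {(\<lambda>v. v + w) ` V | V w. V \<in> \<B>})"

(* Throughout, the finite type 'a is the field with q^t elements. A polynomial f enters the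
   constructions below only through the function it induces on 'a; they are intended for
   scattered linearized f, and the base field with q elements matters only for that notion. *)

definition U_set :: "'a::{field,finite} poly \<Rightarrow> ('a \<times> 'a) set" where
  "U_set f = {(x, poly f x) | x. True}"

definition L_set :: "'a::{field,finite} poly \<Rightarrow> 'a set" where
  "L_set f = {poly f x / x | x. x \<noteq> 0}"

definition scale_pair :: "'a::{field,finite} \<Rightarrow> 'a \<times> 'a \<Rightarrow> 'a \<times> 'a" where
  "scale_pair h v = (h * fst v, h * snd v)"

definition spread_of :: "'a::{field,finite} poly \<Rightarrow> ('a \<times> 'a) set set" where
  "spread_of f =
     {{scale_pair c (1, m) | c. True} | m. m \<notin> L_set f} \<union>
     {scale_pair h ` U_set f | h. h \<noteq> 0} \<union>
     {{0} \<times> UNIV}"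

definition plane_of :: "'a::{field,finite} poly \<Rightarrow> ('a \<times> 'a) plane" where
  "plane_of f = translation_plane (spread_of f)"

end

theory Submission
  imports Defs
begin

text \<open>
  Put \<open>F\<close> for the field with \<open>q\<^sup>t\<close> elements and \<open>Q = q\<^sup>s\<close>, \<open>Q' = q\<^bsup>s'\<^esup>\<close>. By the parallelogram rule an
  isomorphism of translation planes fixing \<open>0\<close> is an additive map \<open>\<phi>\<close> carrying one spread to the
  other. At most \<open>(q\<^sup>t - 1) / (q - 1)\<close> members of either spread are not \<open>F\<close>-lines, so, as \<open>q > 3\<close>,
  more than a third of the \<open>F\<close>-lines go to \<open>F\<close>-lines. Relative to three of these, their slopes
  lie in a subfield of \<open>F\<close> of size exceeding the square root of \<open>q\<^sup>t\<close>, which must be \<open>F\<close>; hence \<open>\<phi>\<close> is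
  \<open>F\<close>-semilinear. It therefore maps \<open>U\<^sub>f\<close> to a multiple of \<open>U\<^sub>f\<^sub>'\<close>, which gives an identity
  \<open>c X + d X\<^sup>Q = e (a X + b X\<^sup>Q)\<^bsup>Q'\<^esup>\<close> on \<open>F\<close>. Unless \<open>s \<equiv> \<plusminus>s'\<close> modulo \<open>t\<close>, the monomials \<open>X\<close> and \<open>X\<^sup>Q\<close>
  are independent of those on the right and \<open>c = d = 0\<close>, contradicting surjectivity. Conversely, for
  \<open>s \<equiv> -s'\<close> the two Frobenius powers are inverse to each other and swapping coordinates is an
  isomorphism.
\<close>

section \<open>Isomorphisms of translation planes\<close>

text \<open>Members are additive subgroups, because the plane sees only the addition of vectors.
  Given the other axioms, \<open>proper\<close> amounts to the presence of at least three
  members.\<close>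

locale planar_spread =
  fixes \<B> :: "'v::ab_group_add set set"
  assumes zero_mem: "V \<in> \<B> \<Longrightarrow> 0 \<in> V"
    and diff_mem: "V \<in> \<B> \<Longrightarrow> x \<in> V \<Longrightarrow> y \<in> V \<Longrightarrow> x - y \<in> V"
    and inter_trivial: "V \<in> \<B> \<Longrightarrow> W \<in> \<B> \<Longrightarrow> V \<noteq> W \<Longrightarrow> V \<inter> W = {0}"
    and sum_exists: "V \<in> \<B> \<Longrightarrow> W \<in> \<B> \<Longrightarrow> V \<noteq> W \<Longrightarrow> \<exists>x\<in>V. \<exists>y\<in>W. v = x + y"
    and cover: "\<exists>V\<in>\<B>. v \<in> V"
    and proper: "V \<in> \<B> \<Longrightarrow> V \<noteq> UNIV"
begin

lemma uminus_mem: "V \<in> \<B> \<Longrightarrow> x \<in> V \<Longrightarrow> - x \<in> V"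
  using diff_mem[of V 0 x] zero_mem by simp

lemma add_mem: "V \<in> \<B> \<Longrightarrow> x \<in> V \<Longrightarrow> y \<in> V \<Longrightarrow> x + y \<in> V"
  using diff_mem[of V x "- y"] uminus_mem by simp

lemma coset_eq:
  assumes "V \<in> \<B>" and "x \<in> (\<lambda>v. v + w) ` V"
  shows "(\<lambda>v. v + w) ` V = (\<lambda>v. v + x) ` V"
proof -
  obtain a where a: "a \<in> V" "x = a + w" using assms(2) by auto
  show ?thesis
  proof (intro equalityI subsetI)
    fix y assume "y \<in> (\<lambda>v. v + w) ` V"
    then obtain v where v: "v \<in> V" "y = v + w" by auto
    then have "y = (v - a) + x" using a by simp
    then show "y \<in> (\<lambda>v. v + x) ` V" using diff_mem[OF assms(1) v(1) a(1)] by blast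
  next
    fix y assume "y \<in> (\<lambda>v. v + x) ` V"
    then obtain v where v: "v \<in> V" "y = v + x" by auto
    then have "y = (v + a) + w" using a by (simp add: add_ac)
    then show "y \<in> (\<lambda>v. v + w) ` V" using add_mem[OF assms(1) v(1) a(1)] by blast
  qed
qed

lemma coset_self: "V \<in> \<B> \<Longrightarrow> x \<in> V \<Longrightarrow> (\<lambda>v. v + x) ` V = V"
  using coset_eq[of V x 0] by simp

end

text \<open>Parallelogram rule: translated so as to fix 0, the map preserves parallelism, and
  \<open>u + v\<close> is the fourth vertex of the parallelogram on 0, \<open>u\<close>,
  \<open>v\<close>.\<close>

theorem isomorphic_translation_planes_additive:
  fixes \<B> :: "'v::ab_group_add set set" and \<B>' :: "'w::ab_group_add set set"
  assumes "planar_spread \<B>" and "planar_spread \<B>'"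
    and "isomorphic_planes (translation_plane \<B>) (translation_plane \<B>')"
  obtains \<psi> :: "'v \<Rightarrow> 'w"
  where "bij \<psi>" and "\<And>u v. \<psi> (u + v) = \<psi> u + \<psi> v" and "\<And>V. V \<in> \<B> \<Longrightarrow> \<psi> ` V \<in> \<B>'"
proof -
  interpret B: planar_spread \<B> by fact
  interpret B': planar_spread \<B>' by fact
  obtain \<phi> :: "'v \<Rightarrow> 'w" where bij_\<phi>: "bij \<phi>"
    and lines: "\<forall>l\<in>lines (translation_plane \<B>). \<phi> ` l \<in> lines (translation_plane \<B>')"
    using assms(3) unfolding isomorphic_planes_def by (auto simp: translation_plane_def)
  have \<phi>_line: "\<exists>W\<in>\<B>'. \<exists>w'. \<phi> ` (\<lambda>v. v + w) ` V = (\<lambda>v. v + w') ` W"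
    if V: "V \<in> \<B>" for V w
  proof -
    have "(\<lambda>v. v + w) ` V \<in> lines (translation_plane \<B>)"
      unfolding translation_plane_def using V by auto
    then have "\<phi> ` (\<lambda>v. v + w) ` V \<in> lines (translation_plane \<B>')" using lines by blast
    then show ?thesis unfolding translation_plane_def snd_conv mem_Collect_eq by blast
  qed
  define \<psi> where "\<psi> v = \<phi> v - \<phi> 0" for v
  have \<psi>_comp: "\<psi> = (\<lambda>v. v - \<phi> 0) \<circ> \<phi>" by (rule ext) (simp add: \<psi>_def)
  have "bij (\<lambda>v. v - \<phi> 0)" by (rule bij_betw_byWitness[of _ "\<lambda>v. v + \<phi> 0"]) auto
  then have bij_\<psi>: "bij \<psi>" unfolding \<psi>_comp by (rule bij_comp[OF bij_\<phi>])
  then have inj_\<psi>: "inj \<psi>" by (rule bij_is_inj)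
  have \<psi>_0: "\<psi> 0 = 0" by (simp add: \<psi>_def)
  have \<psi>_line: "\<exists>W\<in>\<B>'. \<exists>w'. \<psi> ` (\<lambda>v. v + w) ` V = (\<lambda>v. v + w') ` W" if V: "V \<in> \<B>" for V w
  proof -
    obtain W w' where W: "W \<in> \<B>'" "\<phi> ` (\<lambda>v. v + w) ` V = (\<lambda>v. v + w') ` W"
      using \<phi>_line[OF V, of w] by (elim bexE exE) (rule that)
    have "\<psi> ` (\<lambda>v. v + w) ` V = (\<lambda>v. v - \<phi> 0) ` \<phi> ` (\<lambda>v. v + w) ` V"
      unfolding \<psi>_comp by (simp only: image_comp comp_assoc)
    also have "\<dots> = (\<lambda>v. v + (w' - \<phi> 0)) ` W"
      unfolding W(2) by (auto simp: image_image algebra_simps)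
    finally show ?thesis using W(1) by (intro bexI[of _ W] exI)
  qed
  have \<psi>_mem: "\<psi> ` V \<in> \<B>'" if V: "V \<in> \<B>" for V
  proof -
    obtain W w' where W: "W \<in> \<B>'" "\<psi> ` V = (\<lambda>v. v + w') ` W"
      using \<psi>_line[OF V, of 0] by auto
    have "0 \<in> \<psi> ` V" using \<psi>_0 B.zero_mem[OF V] by force
    then have "\<psi> ` V = (\<lambda>v. v + 0) ` W" using B'.coset_eq[OF W(1), of 0 w'] W(2) by simp
    then show ?thesis using W(1) by simp
  qed
  have \<psi>_coset: "\<psi> ` (\<lambda>x. x + v) ` V = (\<lambda>x. x + \<psi> v) ` \<psi> ` V" if V: "V \<in> \<B>" for V v
  proof (cases "v \<in> V")
    case True
    then show ?thesis
      using B.coset_self[OF V] B'.coset_self[OF \<psi>_mem[OF V], of "\<psi> v"] by simp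
  next
    case False
    obtain W w' where W: "W \<in> \<B>'" "\<psi> ` (\<lambda>x. x + v) ` V = (\<lambda>x. x + w') ` W"
      using \<psi>_line[OF V, of v] by (elim bexE exE) (rule that)
    have "(\<lambda>x. x + v) ` V \<inter> V = {}"
    proof -
      have "False" if "x \<in> V" "x + v \<in> V" for x
        using B.diff_mem[OF V that(2,1)] False by simp
      then show ?thesis by blast
    qed
    then have disj: "(\<lambda>x. x + w') ` W \<inter> \<psi> ` V = {}"
      using image_Int[OF inj_\<psi>] W(2) by (metis image_empty)
    \<comment> \<open>Cosets of distinct members always meet, so a line disjoint from the image of
      \<open>V\<close> must be parallel to it.\<close>
    have "W = \<psi> ` V"
    proof (rule ccontr)
      assume "W \<noteq> \<psi> ` V"
      then obtain x y where xy: "x \<in> W" "y \<in> \<psi> ` V" "w' = x + y"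
        using B'.sum_exists[OF W(1) \<psi>_mem[OF V]] by blast
      then have "y = - x + w'" by simp
      then have "y \<in> (\<lambda>x. x + w') ` W" using B'.uminus_mem[OF W(1) xy(1)] by blast
      then show False using xy(2) disj by blast
    qed
    moreover have "\<psi> v \<in> (\<lambda>x. x + w') ` W"
      using W(2) B.zero_mem[OF V] by (metis add_0 image_eqI)
    ultimately show ?thesis using B'.coset_eq[OF W(1)] W(2) by metis
  qed
  \<comment> \<open>\<open>u + v\<close> is the common point of \<open>V + v\<close> and
    \<open>W + u\<close>. The images of these two lines meet only in
    \<open>\<psi> u + \<psi> v\<close>.\<close>
  have \<psi>_add_distinct: "\<psi> (u + v) = \<psi> u + \<psi> v"
    if V: "V \<in> \<B>" "u \<in> V" and W: "W \<in> \<B>" "v \<in> W" and ne: "V \<noteq> W" for u v V W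
  proof -
    have "\<psi> (u + v) \<in> \<psi> ` (\<lambda>x. x + v) ` V" using V by blast
    then obtain a where a: "a \<in> \<psi> ` V" "\<psi> (u + v) = a + \<psi> v"
      unfolding \<psi>_coset[OF V(1)] by blast
    have "\<psi> (v + u) \<in> \<psi> ` (\<lambda>x. x + u) ` W" using W by blast
    then obtain b where b: "b \<in> \<psi> ` W" "\<psi> (v + u) = b + \<psi> u"
      unfolding \<psi>_coset[OF W(1)] by blast
    have "a - \<psi> u \<in> \<psi> ` V" using B'.diff_mem[OF \<psi>_mem[OF V(1)] a(1)] V(2) by blast
    moreover have "b - \<psi> v \<in> \<psi> ` W" using B'.diff_mem[OF \<psi>_mem[OF W(1)] b(1)] W(2) by blast
    moreover have eq: "a - \<psi> u = b - \<psi> v"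
      using a(2) b(2) by (simp add: add.commute[of v u] algebra_simps)
    moreover have "\<psi> ` V \<noteq> \<psi> ` W" using ne inj_image_eq_iff[OF inj_\<psi>] by blast
    ultimately have "a - \<psi> u = 0"
      using B'.inter_trivial[OF \<psi>_mem[OF V(1)] \<psi>_mem[OF W(1)]] by (metis IntI singletonD)
    then show ?thesis using a(2) by simp
  qed
  have "\<psi> (u + v) = \<psi> u + \<psi> v" for u v
  proof -
    obtain V W where V: "V \<in> \<B>" "u \<in> V" and W: "W \<in> \<B>" "v \<in> W" using B.cover by metis
    show ?thesis
    proof (cases "V = W")
      case True
      \<comment> \<open>Inside one member the parallelogram degenerates; an auxiliary
        \<open>w\<close> outside it reduces to distinct members through
        \<open>(u + v) + w = v + (u + w)\<close>.\<close>
      obtain w where w: "w \<notin> V" using B.proper[OF V(1)] by blast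
      have add_w: "\<psi> (x + y) = \<psi> x + \<psi> y" if "x \<in> V" "y \<notin> V" for x y
        using \<psi>_add_distinct[OF V(1) that(1)] B.cover[of y] that(2) by blast
      have uw: "u + w \<notin> V" using B.diff_mem[OF V(1) _ V(2), of "u + w"] w by auto
      have "\<psi> (u + v) + \<psi> w = \<psi> ((u + v) + w)"
        using add_w[OF _ w] B.add_mem V W True by metis
      also have "\<dots> = \<psi> (v + (u + w))" by (simp add: add_ac)
      also have "\<dots> = \<psi> v + (\<psi> u + \<psi> w)"
        using add_w[OF _ uw] add_w[OF V(2) w] W True by simp
      finally show ?thesis by (simp add: add_ac)
    qed (use \<psi>_add_distinct V W in blast)
  qed
  then show thesis using that bij_\<psi> \<psi>_mem by blast
qed


section \<open>Finite fields\<close>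

text \<open>Multiplication by \<open>x\<close> permutes the nonzero elements and so preserves their
  product, which is cancelled.\<close>

lemma finite_field_power_CARD:
  fixes x :: "'a::{field,finite}"
  assumes "x \<noteq> 0"
  shows "x ^ (CARD('a) - 1) = 1"
proof -
  define P where "P = \<Prod>(UNIV - {0 :: 'a})"
  have "P = (\<Prod>y\<in>UNIV - {0}. x * y)" unfolding P_def
    by (rule prod.reindex_bij_witness[of _ "\<lambda>y. x * y" "\<lambda>y. y / x"]) (use assms in auto)
  also have "\<dots> = x ^ (CARD('a) - 1) * P"
    by (simp add: P_def prod.distrib card_Diff_singleton)
  finally show ?thesis by (simp add: P_def)
qed

lemma finite_field_power_CARD_power:
  fixes x :: "'a::{field,finite}"
  shows "x ^ (CARD('a) ^ k) = x"
proof (induction k)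
  case (Suc k)
  have "x ^ CARD('a) = x"
  proof (cases "x = 0")
    case False
    have "x ^ CARD('a) = x ^ Suc (CARD('a) - 1)" by simp
    then show ?thesis using finite_field_power_CARD[OF False] by (simp only: power_Suc) simp
  qed simp
  then show ?case using Suc by (simp add: power_mult)
qed simp

text \<open>Translation by 1 permutes the field and so preserves the sum of all elements.\<close>

lemma of_nat_CARD_eq_0: "of_nat CARD('a) = (0 :: 'a::{field,finite})"
proof -
  have "(\<Sum>x\<in>UNIV. x) = (\<Sum>x\<in>UNIV. x + (1 :: 'a))"
    by (rule sum.reindex_bij_witness[of _ "\<lambda>x. x + 1" "\<lambda>x. x - 1"]) auto
  then show ?thesis by (simp add: sum.distrib)
qed

text \<open>The characteristic divides \<open>q ^ t\<close>, hence is the prime underlying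
  \<open>q\<close>, and \<open>q ^ k\<close> is one of its powers.\<close>

lemma power_add_of_CARD:
  fixes x y :: "'a::{field,finite}"
  assumes "primepow q" and "CARD('a) = q ^ t"
  shows "(x + y) ^ (q ^ k) = x ^ (q ^ k) + y ^ (q ^ k)"
proof -
  obtain p e where p: "prime p" "e > 0" "q = p ^ e" using assms(1) by (auto simp: primepow_def)
  have "CHAR('a) > 0" by (rule finite_imp_CHAR_pos) simp
  then have prime: "prime CHAR('a)" by (rule prime_CHAR_semidom)
  have "CHAR('a) dvd CARD('a)" using of_nat_CARD_eq_0 of_nat_eq_0_iff_char_dvd by blast
  then have "CHAR('a) dvd p" using assms(2) p(3) prime prime_dvd_power by metis
  then have "CHAR('a) = p" using prime p(1) primes_dvd_imp_eq by blast
  then have "q ^ k = CHAR('a) ^ (e * k)" using p(3) by (simp add: power_mult)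
  then show ?thesis using freshmans_dream'[OF prime] by blast
qed

text \<open>An element \<open>z\<close> outside the subfield \<open>K\<close> is independent of 1
  over \<open>K\<close>, so the elements \<open>a + z * b\<close> would number
  \<open>card K ^ 2\<close>.\<close>

lemma large_subfield_eq_UNIV:
  fixes K :: "'a::{field,finite} set"
  assumes diff: "\<And>x y. x \<in> K \<Longrightarrow> y \<in> K \<Longrightarrow> x - y \<in> K"
    and div: "\<And>x y. x \<in> K \<Longrightarrow> y \<in> K \<Longrightarrow> y \<noteq> 0 \<Longrightarrow> x / y \<in> K"
    and card: "CARD('a) < card K ^ 2"
  shows "K = UNIV"
proof (rule ccontr)
  assume "K \<noteq> UNIV"
  then obtain z where z: "z \<notin> K" by blast
  have "inj_on (\<lambda>(a, b). a + z * b) (K \<times> K)"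
  proof (rule inj_onI, clarify)
    fix a b a' b' assume K: "a \<in> K" "b \<in> K" "a' \<in> K" "b' \<in> K" and eq: "a + z * b = a' + z * b'"
    have *: "z * (b - b') = a' - a" using eq by (simp add: algebra_simps)
    have "b = b'"
    proof (rule ccontr)
      assume "b \<noteq> b'"
      then have "z = (a' - a) / (b - b')" using * by (simp add: field_simps)
      then show False using z diff div K \<open>b \<noteq> b'\<close> by auto
    qed
    then show "a = a' \<and> b = b'" using eq by simp
  qed
  then have "card (K \<times> K) \<le> CARD('a)"
    by (intro card_inj_on_le[of _ _ UNIV]) auto
  then show False using card by (simp add: card_cartesian_product power2_eq_square)
qed

section \<open>Polynomial functions and Frobenius monomials\<close>

lemma poly_eq_0_of_degree_less_CARD:
  fixes P :: "'a::{field,finite} poly"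
  assumes "\<And>x. poly P x = 0" and "degree P < CARD('a)"
  shows "P = 0"
  using poly_eqI_degree[of UNIV P 0] assms by simp

lemma Frobenius_power_mod:
  fixes x :: "'a::{field,finite}"
  assumes "CARD('a) = q ^ t"
  shows "x ^ (q ^ k) = x ^ (q ^ (k mod t))"
proof -
  have "q ^ k = CARD('a) ^ (k div t) * q ^ (k mod t)"
    by (metis assms mult_div_mod_eq power_add power_mult)
  then show ?thesis by (simp add: power_mult finite_field_power_CARD_power)
qed

text \<open>Reducing the Frobenius exponents modulo \<open>t\<close> brings all degrees below the
  field size, so the identity of functions becomes one of polynomials. The congruence conditions
  keep the exponents of \<open>c\<close> and \<open>d\<close> apart from each other and from those
  on the right.\<close>

lemma Frobenius_monomials_independent:
  fixes a b c d :: "'a::{field,finite}"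
  assumes card: "CARD('a) = q ^ t" and "q > 1" and "t > 0"
    and s: "s mod t \<noteq> 0" "s' mod t \<noteq> 0" "s mod t \<noteq> s' mod t" "(s + s') mod t \<noteq> 0"
    and eq: "\<And>x. c * x + d * x ^ (q ^ s) = a * x ^ (q ^ s') + b * x ^ (q ^ (s + s'))"
  shows "c = 0 \<and> d = 0"
proof -
  define e where "e k = q ^ (k mod t)" for k
  have e_inj: "e k = e l \<longleftrightarrow> k mod t = l mod t" for k l
    using \<open>q > 1\<close> by (simp add: e_def)
  have e0: "e 0 = 1" by (simp add: e_def)
  have e_less: "e k < CARD('a)" for k
    unfolding e_def card using \<open>q > 1\<close> \<open>t > 0\<close> by (simp add: power_strict_increasing)
  have e_pow: "x ^ (q ^ k) = x ^ e k" for x :: 'a and k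
    unfolding e_def by (rule Frobenius_power_mod[OF card])
  define P where "P = monom c (e 0) + monom d (e s) - monom a (e s') - monom b (e (s + s'))"
  have "poly P x = 0" for x
    using eq[of x] unfolding e_pow by (simp add: P_def poly_monom e0)
  moreover have "degree P < CARD('a)"
  proof -
    have deg: "degree (monom x (e k)) \<le> CARD('a) - 1" for x :: 'a and k
      using degree_monom_le[of x "e k"] e_less[of k] by linarith
    have "degree P \<le> CARD('a) - 1"
      unfolding P_def by (intro degree_diff_le degree_add_le deg)
    then show ?thesis using e_less[of 0] by linarith
  qed
  ultimately have P: "P = 0" by (rule poly_eq_0_of_degree_less_CARD)
  have ne: "s mod t \<noteq> (s + s') mod t"
  proof
    assume "s mod t = (s + s') mod t"
    then have "[s + 0 = s + s'] (mod t)" by (simp add: cong_def)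
    then have "[0 = s'] (mod t)" by (simp only: cong_add_lcancel_nat)
    then show False using s(2) by (simp add: cong_def)
  qed
  have "coeff P (e 0) = c" "coeff P (e s) = d"
    using s ne by (auto simp: P_def e_inj)
  then show ?thesis using P by simp
qed

section \<open>Semilinear maps of the plane\<close>

lemma scale_pair_Pair [simp]: "scale_pair c (x, y) = (c * x, c * y)"
  by (simp add: scale_pair_def)

lemma scale_pair_add: "scale_pair c (u + v) = scale_pair c u + scale_pair c v"
  by (simp add: scale_pair_def prod_eq_iff algebra_simps)

lemma scale_pair_add_left: "scale_pair (c + d) v = scale_pair c v + scale_pair d v"
  by (simp add: scale_pair_def prod_eq_iff algebra_simps)

lemma scale_pair_scale_pair: "scale_pair c (scale_pair d v) = scale_pair (c * d) v"
  by (simp add: scale_pair_def mult.assoc)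

lemma scale_pair_1 [simp]: "scale_pair 1 v = v"
  by (simp add: scale_pair_def)

lemma scale_pair_0 [simp]: "scale_pair 0 v = 0"
  by (simp add: scale_pair_def prod_eq_iff)

lemma scale_pair_0_right [simp]: "scale_pair c 0 = 0"
  by (simp add: scale_pair_def prod_eq_iff)

lemma scale_pair_eq_iff: "scale_pair c v = scale_pair d v \<longleftrightarrow> c = d \<or> v = 0"
  by (cases v) (auto simp: zero_prod_def)

text \<open>The span over the large field, not to be confused with the \<open>lines\<close> of a
  plane, which are cosets of arbitrary spread members.\<close>

definition line :: "'a::{field,finite} \<times> 'a \<Rightarrow> ('a \<times> 'a) set" where
  "line v = range (\<lambda>c. scale_pair c v)"

lemma mem_line: "v \<in> line v"
  unfolding line_def by (metis rangeI scale_pair_1)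

lemma scale_pair_mem_line: "u \<in> line v \<Longrightarrow> scale_pair c u \<in> line v"
  unfolding line_def by (auto simp: scale_pair_scale_pair)

lemma mem_line_trans:
  assumes "u \<in> line w" and "v \<in> line w" and "v \<noteq> 0"
  shows "\<exists>c. u = scale_pair c v"
proof -
  obtain a b where ab: "u = scale_pair a w" "v = scale_pair b w"
    using assms by (auto simp: line_def)
  with assms(3) have "b \<noteq> 0" by auto
  then have "u = scale_pair (a / b) v" using ab by (simp add: scale_pair_scale_pair)
  then show ?thesis by blast
qed

section \<open>Additive maps that preserve lines through the origin\<close>

definition additive :: "('v::ab_group_add \<Rightarrow> 'w::ab_group_add) \<Rightarrow> bool" where
  "additive \<phi> \<longleftrightarrow> (\<forall>u v. \<phi> (u + v) = \<phi> u + \<phi> v)"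

lemma additive_add: "additive \<phi> \<Longrightarrow> \<phi> (u + v) = \<phi> u + \<phi> v"
  by (simp add: additive_def)

lemma additive_0: "additive \<phi> \<Longrightarrow> \<phi> 0 = 0"
  using additive_add[of \<phi> 0 0] by simp

lemma additive_diff: "additive \<phi> \<Longrightarrow> \<phi> (u - v) = \<phi> u - \<phi> v"
  using additive_add[of \<phi> "u - v" v] by simp

lemma scale_pair_independent:
  assumes "w \<notin> line v" and "v \<noteq> 0"
    and "scale_pair a v + scale_pair b w = scale_pair c v + scale_pair d w"
  shows "a = c \<and> b = d"
proof -
  have *: "scale_pair (b - d) w = scale_pair (c - a) v"
    using assms(3) by (simp add: scale_pair_def prod_eq_iff algebra_simps)
  have "b = d"
  proof (rule ccontr)
    assume "b \<noteq> d"
    then have "w = scale_pair (1 / (b - d)) (scale_pair (b - d) w)"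
      by (simp add: scale_pair_scale_pair)
    then have "w \<in> line v" unfolding * by (simp add: scale_pair_scale_pair line_def)
    then show False using assms(1) by contradiction
  qed
  moreover have "a = c" using * assms(2) \<open>b = d\<close> scale_pair_eq_iff[of 0 v "c - a"] by simp
  ultimately show ?thesis by simp
qed

text \<open>Reads off the action on scalars along a single line. Finiteness turns injectivity of
  \<open>\<alpha>\<close> into bijectivity; multiplicativity cannot be seen from one line.\<close>

lemma additive_scalar_factor:
  fixes \<phi> :: "'a::{field,finite} \<times> 'a \<Rightarrow> 'a \<times> 'a"
  assumes inj: "inj \<phi>" and add: "additive \<phi>" and v: "v \<noteq> 0"
    and scale: "\<And>x. \<exists>y. \<phi> (scale_pair x v) = scale_pair y (\<phi> v)"
  obtains \<alpha> where "\<And>x. \<phi> (scale_pair x v) = scale_pair (\<alpha> x) (\<phi> v)"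
    and "additive \<alpha>" and "bij \<alpha>" and "\<alpha> 1 = 1"
proof -
  obtain \<alpha> where \<alpha>: "\<And>x. \<phi> (scale_pair x v) = scale_pair (\<alpha> x) (\<phi> v)"
    using scale by metis
  have "\<phi> v \<noteq> 0" using v additive_0[OF add] injD[OF inj, of v 0] by auto
  then have cancel: "scale_pair c (\<phi> v) = scale_pair d (\<phi> v) \<longleftrightarrow> c = d" for c d
    by (simp add: scale_pair_eq_iff)
  have "inj \<alpha>"
  proof (rule injI)
    fix x y assume "\<alpha> x = \<alpha> y"
    then have "\<phi> (scale_pair x v) = \<phi> (scale_pair y v)" by (simp add: \<alpha>)
    then have "scale_pair x v = scale_pair y v" by (rule injD[OF inj])
    then show "x = y" using v by (simp add: scale_pair_eq_iff)
  qed
  then have "bij \<alpha>" by (simp add: bij_def finite_UNIV_inj_surj)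
  moreover have "additive \<alpha>" unfolding additive_def
  proof (intro allI)
    fix x y
    have "scale_pair (\<alpha> (x + y)) (\<phi> v) = scale_pair (\<alpha> x + \<alpha> y) (\<phi> v)"
      by (metis \<alpha> scale_pair_add_left additive_add[OF add])
    then show "\<alpha> (x + y) = \<alpha> x + \<alpha> y" by (simp only: cancel)
  qed
  moreover have "\<alpha> 1 = 1" using \<alpha>[of 1] cancel[of 1 "\<alpha> 1"] by simp
  ultimately show thesis using that \<alpha> by blast
qed

text \<open>
  With the images of three lines normalised to the two axes and the diagonal, \<open>\<phi>\<close> becomes
  \<open>(x, y) \<mapsto> (\<alpha> x, \<alpha> y)\<close>, and the slopes of the lines that are mapped to lines form a subfield.
\<close>

lemma semilinear_of_many_lines:
  fixes \<phi> :: "'a::{field,finite} \<times> 'a \<Rightarrow> 'a \<times> 'a"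
  assumes inj: "inj \<phi>" and add: "additive \<phi>"
    and M: "\<And>m x. m \<in> M \<Longrightarrow> \<exists>y. \<phi> (scale_pair x (1, m)) = scale_pair y (\<phi> (1, m))"
    and card3: "card M \<ge> 3" and card2: "CARD('a) < (card M - 1) ^ 2"
  obtains \<sigma> :: "'a \<Rightarrow> 'a" where "bij \<sigma>" and "\<And>x y. \<sigma> (x * y) = \<sigma> x * \<sigma> y" and "\<sigma> 1 = 1"
    and "\<And>c v. \<phi> (scale_pair c v) = scale_pair (\<sigma> c) (\<phi> v)"
proof -
  obtain S where "S \<subseteq> M" "card S = 3" using card3 obtain_subset_with_card_n by metis
  then obtain m0 m1 m2 where m: "m0 \<in> M" "m1 \<in> M" "m2 \<in> M" and
    ne: "m0 \<noteq> m1" "m0 \<noteq> m2" "m1 \<noteq> m2"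
    by (auto simp: card_3_iff)
  \<comment> \<open>Chosen so that \<open>(1, m0) + c (1, m1)\<close> has slope \<open>m2\<close>:
    then \<open>v0\<close>, \<open>v1\<close> and \<open>v0 + v1\<close> span the three chosen
    lines.\<close>
  define c where "c = (m2 - m0) / (m1 - m2)"
  have c0: "c \<noteq> 0" and c1: "1 + c \<noteq> 0" and cm: "m0 + c * m1 = (1 + c) * m2"
    using ne by (auto simp: c_def field_simps)
  define v0 v1 :: "'a \<times> 'a" where "v0 = (1, m0)" and "v1 = (c, c * m1)"
  \<comment> \<open>Passes from the generator \<open>(1, n)\<close> of a line to an arbitrary
    nonzero one.\<close>
  have M_scale: "\<exists>y. \<phi> (scale_pair x (d, d * n)) = scale_pair y (\<phi> (d, d * n))"
    if nd: "n \<in> M" "d \<noteq> 0" for n x d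
  proof -
    obtain y where y: "\<phi> (scale_pair d (1, n)) = scale_pair y (\<phi> (1, n))"
      using M[OF nd(1)] by blast
    obtain z where z: "\<phi> (scale_pair (x * d) (1, n)) = scale_pair z (\<phi> (1, n))"
      using M[OF nd(1)] by blast
    have "\<phi> (d, d * n) \<noteq> 0"
      using injD[OF inj, of "(d, d * n)" 0] additive_0[OF add] nd(2) by (auto simp: zero_prod_def)
    with y have "y \<noteq> 0" by auto
    then have "\<phi> (scale_pair x (d, d * n)) = scale_pair (z / y) (\<phi> (d, d * n))"
      using y z by (simp add: scale_pair_scale_pair mult.assoc)
    then show ?thesis by blast
  qed
  have v_nz: "v0 \<noteq> 0" "v1 \<noteq> 0" "v0 + v1 \<noteq> 0"
    using c0 c1 by (auto simp: v0_def v1_def zero_prod_def)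
  have v0v1: "v0 + v1 = (1 + c, (1 + c) * m2)" using cm by (simp add: v0_def v1_def)
  obtain \<alpha> where \<alpha>: "\<And>x. \<phi> (scale_pair x v0) = scale_pair (\<alpha> x) (\<phi> v0)"
      and \<alpha>_add: "additive \<alpha>" and \<alpha>_bij: "bij \<alpha>" and \<alpha>_1: "\<alpha> 1 = 1"
    using additive_scalar_factor[OF inj add v_nz(1)] M_scale[OF m(1), of 1] by (auto simp: v0_def)
  obtain \<beta> where \<beta>: "\<And>x. \<phi> (scale_pair x v1) = scale_pair (\<beta> x) (\<phi> v1)"
    using M_scale[OF m(2) c0] unfolding v1_def by metis
  obtain \<gamma> where \<gamma>: "\<And>x. \<phi> (scale_pair x (v0 + v1)) = scale_pair (\<gamma> x) (\<phi> (v0 + v1))"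
    using M_scale[OF m(3) c1] unfolding v0v1 by metis
  have "v1 \<notin> line v0" using ne c0 by (auto simp: line_def v0_def v1_def)
  \<comment> \<open>As \<open>\<alpha>\<close> is onto, the image of \<open>line v0\<close> fills
    \<open>line (\<phi> v0)\<close>, and injectivity leaves no room for
    \<open>\<phi> v1\<close>.\<close>
  then have indep: "\<phi> v1 \<notin> line (\<phi> v0)"
  proof (rule contrapos_nn)
    assume "\<phi> v1 \<in> line (\<phi> v0)"
    then obtain d where "\<phi> v1 = scale_pair d (\<phi> v0)" by (auto simp: line_def)
    moreover obtain x where "d = \<alpha> x" using \<alpha>_bij by (metis bij_pointE)
    ultimately have "\<phi> v1 = \<phi> (scale_pair x v0)" by (simp add: \<alpha>)
    then have "v1 = scale_pair x v0" by (rule injD[OF inj])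
    then show "v1 \<in> line v0" by (simp add: line_def)
  qed
  have \<phi>v0: "\<phi> v0 \<noteq> 0" using v_nz(1) additive_0[OF add] injD[OF inj, of v0 0] by auto
  \<comment> \<open>The diagonal line links the two axes: both coordinates of its image are scaled
    by the same \<open>\<gamma> x\<close>.\<close>
  have \<beta>_eq: "\<beta> x = \<alpha> x" for x
  proof -
    have "scale_pair (\<alpha> x) (\<phi> v0) + scale_pair (\<beta> x) (\<phi> v1) =
          scale_pair (\<gamma> x) (\<phi> v0) + scale_pair (\<gamma> x) (\<phi> v1)"
      using \<gamma>[of x] by (simp add: scale_pair_add additive_add[OF add] \<alpha> \<beta>)
    from scale_pair_independent[OF indep \<phi>v0 this] show ?thesis by simp
  qed
  have \<phi>_eq: "\<phi> (scale_pair x v0 + scale_pair y v1) =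
      scale_pair (\<alpha> x) (\<phi> v0) + scale_pair (\<alpha> y) (\<phi> v1)" for x y
    by (simp add: additive_add[OF add] \<alpha> \<beta> \<beta>_eq)
  have \<alpha>_0: "\<alpha> x = 0 \<longleftrightarrow> x = 0" for x
    using additive_0[OF \<alpha>_add] bij_is_inj[OF \<alpha>_bij] by (metis injD)
  \<comment> \<open>The scalars over which \<open>\<alpha>\<close> is semilinear form a subfield; it
    remains to bound its size from below.\<close>
  define K where "K = {k. \<forall>x. \<alpha> (k * x) = \<alpha> k * \<alpha> x}"
  have "K = UNIV"
  proof (rule large_subfield_eq_UNIV)
    fix x y assume xy: "x \<in> K" "y \<in> K"
    show "x - y \<in> K"
      using xy by (simp add: K_def left_diff_distrib additive_diff[OF \<alpha>_add])
    assume y0: "y \<noteq> 0"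
    have *: "\<alpha> (z / y) = \<alpha> z / \<alpha> y" for z
    proof -
      have "\<alpha> (y * (z / y)) = \<alpha> y * \<alpha> (z / y)" using xy(2) unfolding K_def by blast
      then show ?thesis using y0 \<alpha>_0[of y] by (simp add: field_simps)
    qed
    show "x / y \<in> K" unfolding K_def
    proof (intro CollectI allI)
      fix z
      have "\<alpha> (x / y * z) = \<alpha> ((x * z) / y)" by simp
      also have "\<dots> = \<alpha> (x / y) * \<alpha> z" using xy(1) by (simp only: *) (simp add: K_def)
      finally show "\<alpha> (x / y * z) = \<alpha> (x / y) * \<alpha> z" .
    qed
  next
    \<comment> \<open>The fraction is the slope of \<open>v0 + k v1\<close>. The slope
      \<open>m1\<close> of \<open>v1\<close> itself corresponds to infinite \<open>k\<close>, which
      explains the loss of one in \<open>card M - 1\<close>.\<close>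
    have "M - {m1} \<subseteq> (\<lambda>k. (m0 + k * c * m1) / (1 + k * c)) ` K"
    proof
      fix n assume n: "n \<in> M - {m1}"
      define k where "k = (n - m0) / (c * (m1 - n))"
      have kc: "k * c * (m1 - n) = n - m0" using c0 n by (auto simp: k_def)
      have d0: "1 + k * c \<noteq> 0"
      proof
        assume "1 + k * c = 0"
        then have "k * c = - 1" by (simp add: add_eq_0_iff)
        then show False using kc ne by simp
      qed
      have kn: "m0 + k * c * m1 = (1 + k * c) * n" using kc by (simp add: algebra_simps)
      have vk: "(1 + k * c, (1 + k * c) * n) = v0 + scale_pair k v1"
        using kn by (simp add: v0_def v1_def mult.assoc)
      \<comment> \<open>The line through \<open>v0 + k v1\<close> goes to a line, so both
        coordinates of the image of a multiple carry the same factor \<open>y\<close>: the first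
        gives \<open>y = \<alpha> x\<close>, the second the product rule.\<close>
      have "k \<in> K" unfolding K_def
      proof (intro CollectI allI)
        fix x
        obtain y where y: "\<phi> (scale_pair x (v0 + scale_pair k v1)) =
            scale_pair y (\<phi> (v0 + scale_pair k v1))"
          using M_scale[of n "1 + k * c"] n d0 unfolding vk by blast
        have "scale_pair (\<alpha> x) (\<phi> v0) + scale_pair (\<alpha> (x * k)) (\<phi> v1) =
            \<phi> (scale_pair x (v0 + scale_pair k v1))"
          by (simp add: \<phi>_eq scale_pair_add scale_pair_scale_pair)
        also have "\<dots> = scale_pair y (\<phi> v0) + scale_pair (y * \<alpha> k) (\<phi> v1)"
          using \<phi>_eq[of 1 k] unfolding y by (simp add: \<alpha>_1 scale_pair_add scale_pair_scale_pair)
        finally have "\<alpha> x = y \<and> \<alpha> (x * k) = y * \<alpha> k"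
          by (rule scale_pair_independent[OF indep \<phi>v0])
        then show "\<alpha> (k * x) = \<alpha> k * \<alpha> x" by (simp add: mult.commute)
      qed
      moreover have "n = (m0 + k * c * m1) / (1 + k * c)" using d0 kn by simp
      ultimately show "n \<in> (\<lambda>k. (m0 + k * c * m1) / (1 + k * c)) ` K" by blast
    qed
    then have "card (M - {m1}) \<le> card K" using surj_card_le[of K] by simp
    then have "card M - 1 \<le> card K" using m(2) by simp
    then have "(card M - 1) ^ 2 \<le> card K ^ 2" by (rule power_mono) simp
    then show "CARD('a) < card K ^ 2" using card2 by linarith
  qed
  then have \<alpha>_mult: "\<alpha> (x * y) = \<alpha> x * \<alpha> y" for x y unfolding K_def by blast
  have "\<phi> (scale_pair d v) = scale_pair (\<alpha> d) (\<phi> v)" for d v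
  proof -
    obtain a b where ab: "v = scale_pair a v0 + scale_pair b v1"
    proof
      define b where "b = (snd v - fst v * m0) / (c * (m1 - m0))"
      have "c * b = (snd v - fst v * m0) / (m1 - m0)" using c0 by (simp add: b_def)
      then have "c * b * (m1 - m0) = snd v - fst v * m0" using ne by simp
      then show "v = scale_pair (fst v - c * b) v0 + scale_pair b v1"
        by (simp add: v0_def v1_def prod_eq_iff algebra_simps)
    qed
    have "scale_pair d v = scale_pair (d * a) v0 + scale_pair (d * b) v1"
      by (simp add: ab scale_pair_add scale_pair_scale_pair)
    then show ?thesis by (simp add: ab \<phi>_eq \<alpha>_mult scale_pair_add scale_pair_scale_pair)
  qed
  then show thesis using that \<alpha>_bij \<alpha>_mult \<alpha>_1 by blast
qed

section \<open>The spread of a Frobenius power\<close>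

text \<open>Abstracts \<open>q ^ s\<close> to an exponent with additive power map, from which the
  spread axioms are derived.\<close>

locale frobenius_power =
  fixes Q :: nat and f :: "'a::{field,finite} poly"
  assumes Q_pos: "Q > 0"
    and power_add: "\<And>x y :: 'a. (x + y) ^ Q = x ^ Q + y ^ Q"
    and f_eq: "f = monom 1 Q"
begin

lemma power_diff_eq: "(x - y :: 'a) ^ Q = x ^ Q - y ^ Q"
  using power_add[of "x - y" y] by simp

lemma poly_f [simp]: "poly f x = x ^ Q"
  by (simp add: f_eq poly_monom)

lemma L_set_eq: "L_set f = {x ^ Q / x | x. x \<noteq> 0}"
  by (simp add: L_set_def)

text \<open>Substitute \<open>1 / h\<close> for \<open>x\<close>. Thus the slopes excluded from the
  spread are also the coefficients of the graphs replacing them.\<close>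

lemma mem_L_set_iff: "c \<in> L_set f \<longleftrightarrow> (\<exists>h. h \<noteq> 0 \<and> c = h / h ^ Q)"
proof
  assume "c \<in> L_set f"
  then obtain x where "x \<noteq> 0" "c = x ^ Q / x" by (auto simp: L_set_eq)
  then show "\<exists>h. h \<noteq> 0 \<and> c = h / h ^ Q"
    by (intro exI[of _ "1 / x"]) (simp add: power_divide)
next
  assume "\<exists>h. h \<noteq> 0 \<and> c = h / h ^ Q"
  then obtain h where "h \<noteq> 0" "c = h / h ^ Q" by blast
  then have "1 / h \<noteq> 0 \<and> c = (1 / h) ^ Q / (1 / h)" by (simp add: power_divide)
  then show "c \<in> L_set f" unfolding L_set_eq by blast
qed

text \<open>Different \<open>h\<close> may give the same multiple of \<open>U_set f\<close>;
  indexing by the coefficient \<open>c\<close> removes this redundancy.\<close>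

definition graph :: "'a \<Rightarrow> ('a \<times> 'a) set" where
  "graph c = range (\<lambda>z. (z, c * z ^ Q))"

lemma scale_U_set:
  assumes "h \<noteq> 0"
  shows "scale_pair h ` U_set f = graph (h / h ^ Q)"
proof (intro equalityI subsetI)
  fix v assume "v \<in> scale_pair h ` U_set f"
  then obtain x where "v = scale_pair h (x, poly f x)" unfolding U_set_def by blast
  then have "v = (h * x, h / h ^ Q * (h * x) ^ Q)" using assms by (simp add: power_mult_distrib)
  then show "v \<in> graph (h / h ^ Q)" unfolding graph_def by blast
next
  fix v assume "v \<in> graph (h / h ^ Q)"
  then obtain z where "v = (z, h / h ^ Q * z ^ Q)" by (auto simp: graph_def)
  then have "v = scale_pair h (z / h, poly f (z / h))" using assms by (simp add: power_divide)
  then show "v \<in> scale_pair h ` U_set f" unfolding U_set_def by blast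
qed

lemma spread_of_eq:
  "spread_of f = {line (1, m) | m. m \<notin> L_set f} \<union> graph ` L_set f \<union> {line (0, 1)}"
proof -
  have "{scale_pair h ` U_set f | h. h \<noteq> 0} = graph ` L_set f"
  proof (intro equalityI subsetI)
    fix V assume "V \<in> graph ` L_set f"
    then obtain h where "h \<noteq> 0" "V = graph (h / h ^ Q)" by (auto simp: mem_L_set_iff)
    then show "V \<in> {scale_pair h ` U_set f | h. h \<noteq> 0}" using scale_U_set by blast
  qed (use scale_U_set mem_L_set_iff in blast)
  moreover have "{0} \<times> UNIV = line (0, 1 :: 'a)" by (auto simp: line_def)
  moreover have "{scale_pair c (1, m) | c. True} = line (1, m)" for m :: 'a
    by (auto simp: line_def)
  ultimately show ?thesis unfolding spread_of_def by simp
qed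

lemma mem_spread_ofE:
  assumes "V \<in> spread_of f"
  obtains m where "m \<notin> L_set f" "V = line (1, m)"
  | c where "c \<in> L_set f" "V = graph c"
  | "V = line (0, 1)"
  using assms unfolding spread_of_eq by auto

text \<open>A nonzero vector determines its member, whence trivial intersections. The point is that
  nonzero vectors of the graph for \<open>h / h ^ Q\<close> have slope
  \<open>(x / h) ^ Q / (x / h)\<close>, which lies in \<open>L_set f\<close>.\<close>

lemma spread_member_unique:
  assumes "V \<in> spread_of f" and "(x, y) \<in> V" and "(x, y) \<noteq> 0"
  shows "V = (if x = 0 then line (0, 1)
              else if y / x \<in> L_set f then graph (y / x ^ Q) else line (1, y / x))"
  using assms(1)
proof (cases rule: mem_spread_ofE)
  case (1 m)
  then show ?thesis using assms(2,3) by (auto simp: line_def zero_prod_def)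
next
  case (2 c)
  then obtain h where h: "h \<noteq> 0" "c = h / h ^ Q" by (auto simp: mem_L_set_iff)
  have y: "y = c * x ^ Q" using 2 assms(2) by (auto simp: graph_def)
  with assms(3) Q_pos have x: "x \<noteq> 0" by (auto simp: zero_prod_def)
  have "y / x = (x / h) ^ Q / (x / h)" using h x y by (simp add: power_divide)
  moreover have "x / h \<noteq> 0" using h(1) x by simp
  ultimately have "y / x \<in> L_set f" unfolding L_set_eq by blast
  then show ?thesis using x y 2 by simp
next
  case 3
  then show ?thesis using assms(2) by (auto simp: line_def)
qed

lemma card_spread_member:
  assumes "V \<in> spread_of f"
  shows "card V = CARD('a)"
  using assms
proof (cases rule: mem_spread_ofE)
  case (1 m)
  have "inj (\<lambda>c. scale_pair c (1, m))" by (rule injI) simp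
  then show ?thesis using 1 by (simp add: line_def card_image)
next
  case (2 c)
  have "inj (\<lambda>z. (z, c * z ^ Q))" by (rule injI) simp
  then show ?thesis using 2 by (simp add: graph_def card_image)
next
  case 3
  have "inj (\<lambda>c. scale_pair c (0, 1 :: 'a))" by (rule injI) simp
  then show ?thesis using 3 by (simp add: line_def card_image)
qed

lemma zero_mem_spread_member: "V \<in> spread_of f \<Longrightarrow> 0 \<in> V"
  by (erule mem_spread_ofE)
    (use Q_pos in \<open>auto simp: line_def graph_def zero_prod_def image_iff intro!: exI[of _ 0]\<close>)

lemma diff_mem_spread_member:
  assumes "V \<in> spread_of f" and "u \<in> V" and "v \<in> V"
  shows "u - v \<in> V"
proof -
  have line: "u - v \<in> line w" if "u \<in> line w" "v \<in> line w" for w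
  proof -
    obtain a b where "u = scale_pair a w" "v = scale_pair b w"
      using \<open>u \<in> line w\<close> \<open>v \<in> line w\<close> by (auto simp: line_def)
    then have "u - v = scale_pair (a - b) w"
      by (simp add: scale_pair_def prod_eq_iff algebra_simps)
    then show ?thesis by (simp add: line_def)
  qed
  show ?thesis using assms(1)
  proof (cases rule: mem_spread_ofE)
    case (2 c)
    then obtain x y where "u = (x, c * x ^ Q)" "v = (y, c * y ^ Q)"
      using assms(2,3) by (auto simp: graph_def)
    then have "u - v = (x - y, c * (x - y) ^ Q)"
      by (simp add: power_diff_eq right_diff_distrib)
    then have "u - v \<in> graph c" unfolding graph_def by (rule range_eqI)
    then show ?thesis using 2 by simp
  qed (use line assms(2,3) in auto)
qed

lemma inter_spread_members:
  assumes "V \<in> spread_of f" and "W \<in> spread_of f" and "V \<noteq> W"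
  shows "V \<inter> W = {0}"
proof -
  have "v = 0" if "v \<in> V" "v \<in> W" for v
  proof (rule ccontr)
    assume "v \<noteq> 0"
    moreover obtain x y where "v = (x, y)" by (cases v)
    ultimately show False
      using spread_member_unique[OF assms(1), of x y] spread_member_unique[OF assms(2), of x y]
        that assms(3) by simp
  qed
  then show ?thesis using zero_mem_spread_member assms by blast
qed

sublocale planar_spread "spread_of f"
proof
  have CARD_gt_1: "CARD('a) > 1"
    using card_mono[of UNIV "{0, 1 :: 'a}"] by simp
  show "V \<noteq> UNIV" if "V \<in> spread_of f" for V
  proof
    assume "V = UNIV"
    then have "CARD('a) * CARD('a) = CARD('a)"
      using card_spread_member[OF \<open>V \<in> spread_of f\<close>] by (simp add: card_prod)
    then show False using CARD_gt_1 by simp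
  qed
  show "\<exists>x\<in>V. \<exists>y\<in>W. v = x + y"
    if V: "V \<in> spread_of f" and W: "W \<in> spread_of f" and ne: "V \<noteq> W" for V W v
  proof -
    \<comment> \<open>Trivial intersection makes addition injective; since each member has
      \<open>CARD('a)\<close> vectors, counting makes it surjective.\<close>
    have "inj_on (\<lambda>(x, y). x + y) (V \<times> W)"
    proof (rule inj_onI, clarify)
      fix x1 x2 y1 y2 z1 z2 w1 w2
      assume mem: "(x1, x2) \<in> V" "(y1, y2) \<in> W" "(z1, z2) \<in> V" "(w1, w2) \<in> W"
        and eq: "(x1, x2) + (y1, y2) = (z1, z2) + (w1, w2)"
      have "(x1, x2) - (z1, z2) = (w1, w2) - (y1, y2)" using eq by (simp add: algebra_simps)
      then have "(x1, x2) - (z1, z2) \<in> V \<inter> W"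
        using diff_mem_spread_member[OF V mem(1,3)] diff_mem_spread_member[OF W mem(4,2)] by simp
      then have "(x1, x2) - (z1, z2) = 0" using inter_spread_members[OF V W ne] by simp
      then show "(x1, x2) = (z1, z2) \<and> (y1, y2) = (w1, w2)" using eq by (simp add: zero_prod_def)
    qed
    then have "card ((\<lambda>(x, y). x + y) ` (V \<times> W)) = CARD('a \<times> 'a)"
      using card_spread_member[OF V] card_spread_member[OF W]
      by (simp add: card_image card_cartesian_product card_prod)
    then have "(\<lambda>(x, y). x + y) ` (V \<times> W) = UNIV" by (intro card_subset_eq) auto
    then have "v \<in> (\<lambda>(x, y). x + y) ` (V \<times> W)" by simp
    then show ?thesis by auto
  qed
  show "\<exists>V\<in>spread_of f. v \<in> V" for v
  proof -
    obtain x y where v: "v = (x, y)" by (cases v)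
    consider "x = 0" | "x \<noteq> 0" "y / x \<notin> L_set f" | z where "x \<noteq> 0" "z \<noteq> 0" "y / x = z ^ Q / z"
      unfolding L_set_eq by auto
    then show ?thesis
    proof cases
      case 1
      then have "v \<in> line (0, 1)" by (simp add: v line_def)
      then show ?thesis by (auto simp: spread_of_eq)
    next
      case 2
      then have "v = scale_pair x (1, y / x)" by (simp add: v)
      then have "v \<in> line (1, y / x)" unfolding line_def by blast
      then show ?thesis using 2 by (auto simp: spread_of_eq)
    next
      case 3
      then have "v = scale_pair (x / z) (z, poly f z)" by (simp add: v field_simps)
      then have "v \<in> scale_pair (x / z) ` U_set f" unfolding U_set_def by blast
      moreover have "scale_pair (x / z) ` U_set f \<in> spread_of f"
        unfolding spread_of_def using 3 by auto
      ultimately show ?thesis by blast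
    qed
  qed
qed (use zero_mem_spread_member diff_mem_spread_member inter_spread_members in auto)

end

text \<open>Elements of \<open>L_set f\<close> are powers \<open>x ^ (q ^ s - 1)\<close>, hence
  powers with exponent \<open>q - 1\<close>, hence roots of \<open>X ^ n - 1\<close> with
  \<open>n = (q ^ t - 1) / (q - 1)\<close>. The factor 3 comes from
  \<open>q - 1 \<ge> 3\<close>.\<close>

lemma three_card_L_set_less:
  fixes f :: "'a::{field,finite} poly"
  assumes "q > 3" and "t > 0" and card: "CARD('a) = q ^ t" and f: "f = monom 1 (q ^ s)"
  shows "3 * card (L_set f) < CARD('a)"
proof -
  have dvd: "q - 1 dvd q ^ k - 1" for k
  proof -
    have "[q = 1] (mod q - 1)" using \<open>q > 3\<close> by (subst cong_altdef_nat) auto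
    then have "[q ^ k = 1 ^ k] (mod q - 1)" by (rule cong_pow)
    then show ?thesis using cong_to_1_nat by simp
  qed
  obtain n where n: "CARD('a) - 1 = (q - 1) * n" using dvd[of t] card by (auto elim: dvdE)
  obtain k where k: "q ^ s - 1 = (q - 1) * k" using dvd[of s] by (auto elim: dvdE)
  have "q ^ 1 \<le> q ^ t" using assms by (intro power_increasing) auto
  then have "n > 0" using n card \<open>q > 3\<close> by (intro gr0I) auto
  have pow: "z ^ n = 1" if "z \<in> L_set f" for z
  proof -
    obtain x where x: "x \<noteq> 0" "z = x ^ (q ^ s) / x"
      using \<open>z \<in> L_set f\<close> by (auto simp: L_set_def f poly_monom)
    have "x ^ (q ^ s) = x ^ Suc (q ^ s - 1)" using \<open>q > 3\<close> by simp
    then have "z = x ^ (q ^ s - 1)" using x by simp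
    then have "z = x ^ ((q - 1) * k)" by (simp only: k)
    then have "z ^ n = x ^ (((q - 1) * n) * k)" by (simp add: mult_ac flip: power_mult)
    also have "\<dots> = 1"
      using finite_field_power_CARD[OF x(1)] by (simp only: n power_mult) simp
    finally show ?thesis .
  qed
  define P where "P = monom (1 :: 'a) n - 1"
  have "coeff P n = 1" using \<open>n > 0\<close> by (simp add: P_def)
  then have "P \<noteq> 0" by auto
  have "L_set f \<subseteq> {x. poly P x = 0}" using pow by (auto simp: P_def poly_monom)
  then have "card (L_set f) \<le> card {x. poly P x = 0}" by (intro card_mono) auto
  also have "\<dots> \<le> degree P" by (rule card_poly_roots_bound[OF \<open>P \<noteq> 0\<close>])
  also have "\<dots> \<le> n" unfolding P_def by (intro degree_diff_le degree_monom_le) simp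
  finally have "3 * card (L_set f) \<le> (q - 1) * n" using \<open>q > 3\<close> by (intro mult_le_mono) auto
  then show ?thesis using n card \<open>q > 3\<close> by (metis Suc_pred' less_Suc_eq_le zero_less_card_finite)
qed

section \<open>Isomorphism classes of the planes\<close>

lemma inj_line_slope: "inj (\<lambda>m. line (1, m))"
proof (rule injI)
  fix m n :: 'a
  assume "line (1, m) = line (1, n)"
  then have "(1, m) \<in> line (1, n)" using mem_line by metis
  then show "m = n" by (auto simp: line_def)
qed

text \<open>A slope is lost only if it lies in \<open>L_set f\<close> or its line goes to a graph.
  Distinct slopes have distinct images, so the latter happens at most \<open>card (L_set f')\<close>
  times.\<close>

lemma many_lines_to_lines:
  fixes \<phi> :: "'a::{field,finite} \<times> 'a \<Rightarrow> 'a \<times> 'a"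
  assumes "frobenius_power Q f" and "frobenius_power Q' f'" and inj: "inj \<phi>"
    and spread: "\<And>V. V \<in> spread_of f \<Longrightarrow> \<phi> ` V \<in> spread_of f'"
  shows "CARD('a) \<le> card {m. \<exists>w. \<phi> ` line (1, m) = line w} + card (L_set f) + card (L_set f')"
proof -
  interpret F: frobenius_power Q f by fact
  interpret F': frobenius_power Q' f' by fact
  let ?M = "{m. \<exists>w. \<phi> ` line (1, m) = line w}"
  let ?N = "{m. \<phi> ` line (1, m) \<in> F'.graph ` L_set f'}"
  have "inj (\<lambda>m. \<phi> ` line (1, m))"
    using inj_line_slope inj unfolding inj_def inj_image_eq_iff[OF inj] by blast
  then have "card ?N \<le> card (F'.graph ` L_set f')"
    by (intro card_inj_on_le[of "\<lambda>m. \<phi> ` line (1, m)"]) (auto intro: inj_on_subset)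
  also have "\<dots> \<le> card (L_set f')" by (rule card_image_le) simp
  finally have N: "card ?N \<le> card (L_set f')" .
  have "m \<in> ?M \<union> L_set f \<union> ?N" for m
  proof (cases "m \<in> L_set f")
    case False
    then have "\<phi> ` line (1, m) \<in> spread_of f'" by (intro spread) (auto simp: F.spread_of_eq)
    then show ?thesis by (rule F'.mem_spread_ofE) auto
  qed simp
  then have "UNIV = ?M \<union> L_set f \<union> ?N" by blast
  then have "CARD('a) \<le> card (?M \<union> L_set f) + card ?N" by (metis card_Un_le)
  also have "\<dots> \<le> card ?M + card (L_set f) + card (L_set f')"
    using N by (intro add_mono card_Un_le)
  finally show ?thesis .
qed

lemma frobenius_power_monom:
  assumes "primepow q" and "CARD('a::{field,finite}) = q ^ t"
  shows "frobenius_power (q ^ s) (monom (1 :: 'a) (q ^ s))"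
  using assms power_add_of_CARD[OF assms] primepow_gt_0_nat[OF assms(1)]
  by unfold_locales auto

theorem not_isomorphic_planes_of:
  fixes f f' :: "'a::{field,finite} poly"
  assumes q: "primepow q" "q > 3" and "t > 1" and card: "CARD('a) = q ^ t"
    and s: "s mod t \<noteq> 0" "s' mod t \<noteq> 0" "s mod t \<noteq> s' mod t" "(s + s') mod t \<noteq> 0"
    and f: "f = monom 1 (q ^ s)" and f': "f' = monom 1 (q ^ s')"
  shows "\<not> isomorphic_planes (plane_of f) (plane_of f')"
proof
  assume iso: "isomorphic_planes (plane_of f) (plane_of f')"
  have "q > 1" "t > 0" using q \<open>t > 1\<close> by auto
  define Q Q' where "Q = q ^ s" and "Q' = q ^ s'"
  have frob: "frobenius_power Q f" "frobenius_power Q' f'"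
    unfolding f f' Q_def Q'_def using frobenius_power_monom[OF q(1) card] by auto
  interpret F: frobenius_power Q f by (rule frob)
  interpret F': frobenius_power Q' f' by (rule frob)
  obtain \<phi> :: "'a \<times> 'a \<Rightarrow> 'a \<times> 'a"
    where bij: "bij \<phi>" and add': "\<And>u v. \<phi> (u + v) = \<phi> u + \<phi> v"
      and spread: "\<And>V. V \<in> spread_of f \<Longrightarrow> \<phi> ` V \<in> spread_of f'"
    using isomorphic_translation_planes_additive[OF F.planar_spread_axioms F'.planar_spread_axioms]
      iso unfolding plane_of_def by blast
  have inj: "inj \<phi>" using bij by (rule bij_is_inj)
  have add: "additive \<phi>" using add' by (simp add: additive_def)
  define M where "M = {m. \<exists>w. \<phi> ` line (1, m) = line w}"
  have "q ^ 2 \<le> q ^ t" using \<open>q > 1\<close> \<open>t > 1\<close> by (intro power_increasing) auto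
  moreover have "4 ^ 2 \<le> q ^ 2" using q(2) by (intro power_mono) auto
  ultimately have CARD: "CARD('a) \<ge> 16" using card by simp
  have "CARD('a) \<le> card M + card (L_set f) + card (L_set f')"
    unfolding M_def by (rule many_lines_to_lines[OF frob inj spread])
  with three_card_L_set_less[OF q(2) \<open>t > 0\<close> card f] three_card_L_set_less[OF q(2) \<open>t > 0\<close> card f']
  \<comment> \<open>Each of the two strict bounds on \<open>L_set\<close> contributes one to the
    summand 2.\<close>
  have card_M: "3 * card M \<ge> CARD('a) + 2" by linarith
  with CARD have card3: "card M \<ge> 3" by linarith
  \<comment> \<open>With \<open>k = card M - 1\<close> the bound reads
    \<open>CARD('a) \<le> 3 * k + 1\<close>, which is below \<open>k ^ 2\<close> once
    \<open>k \<ge> 5\<close>; 16 elements suffice for that.\<close>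
  have card2: "CARD('a) < (card M - 1) ^ 2"
  proof -
    have "CARD('a) \<le> 3 * (card M - 1) + 1" using card_M by linarith
    moreover have "5 \<le> card M - 1" using CARD card_M by linarith
    then have "5 * (card M - 1) \<le> (card M - 1) ^ 2" by (simp add: power2_eq_square)
    ultimately show ?thesis using \<open>5 \<le> card M - 1\<close> by linarith
  qed
  have M: "\<exists>y. \<phi> (scale_pair x (1, m)) = scale_pair y (\<phi> (1, m))" if m: "m \<in> M" for m x
  proof -
    obtain w where w: "\<phi> ` line (1, m) = line w" using m by (auto simp: M_def)
    have "\<phi> (1, m) \<noteq> 0"
      using injD[OF inj, of "(1, m)" 0] additive_0[OF add] by (auto simp: zero_prod_def)
    moreover have "\<phi> (1, m) \<in> line w" "\<phi> (scale_pair x (1, m)) \<in> line w"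
      using w mem_line[of "(1, m)"] scale_pair_mem_line by blast+
    ultimately show ?thesis using mem_line_trans by blast
  qed
  obtain \<sigma> where \<sigma>_bij: "bij \<sigma>" and \<sigma>_mult: "\<And>x y. \<sigma> (x * y) = \<sigma> x * \<sigma> y" and \<sigma>_1: "\<sigma> 1 = 1"
    and \<sigma>: "\<And>c v. \<phi> (scale_pair c v) = scale_pair (\<sigma> c) (\<phi> v)"
    using semilinear_of_many_lines[OF inj add M card3 card2] by blast
  have \<sigma>_power: "\<sigma> (x ^ n) = \<sigma> x ^ n" for x n
    by (induction n) (simp_all add: \<sigma>_1 \<sigma>_mult)
  \<comment> \<open>Otherwise semilinearity would make \<open>U_set f\<close> closed under all
    scalars, and \<open>(z, z)\<close> in it would force \<open>z ^ Q = z\<close>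
    everywhere.\<close>
  have U_not_line: "\<phi> ` U_set f \<noteq> line w" for w
  proof
    assume eq: "\<phi> ` U_set f = line w"
    have "z ^ Q = z" for z :: 'a
    proof -
      have "(1, 1) \<in> U_set f" by (simp add: U_set_def)
      then have "\<phi> (scale_pair z (1, 1)) \<in> line w" unfolding \<sigma> using eq scale_pair_mem_line by blast
      then have "scale_pair z (1, 1) \<in> U_set f" using eq inj by (metis inj_image_mem_iff)
      then show "z ^ Q = z" by (simp add: U_set_def)
    qed
    then have "1 * x + (- 1) * x ^ (q ^ s) = 0 * x ^ (q ^ s') + 0 * x ^ (q ^ (s + s'))" for x :: 'a
      by (simp add: Q_def)
    from Frobenius_monomials_independent[OF card \<open>q > 1\<close> \<open>t > 0\<close> s this] show False by simp
  qed
  have "U_set f \<in> spread_of f" unfolding spread_of_def by (auto intro!: exI[of _ 1])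
  then have "\<phi> ` U_set f \<in> spread_of f'" by (rule spread)
  then obtain e where e: "\<phi> ` U_set f = F'.graph e"
    using U_not_line by (elim F'.mem_spread_ofE) auto
  \<comment> \<open>The columns of the matrix of \<open>\<phi>\<close>.\<close>
  obtain a c where ac: "\<phi> (1, 0) = (a, c)" by fastforce
  obtain b d where bd: "\<phi> (0, 1) = (b, d)" by fastforce
  have \<phi>_eq: "\<phi> (x, y) = (\<sigma> x * a + \<sigma> y * b, \<sigma> x * c + \<sigma> y * d)" for x y
  proof -
    have "\<phi> (x, y) = \<phi> (scale_pair x (1, 0) + scale_pair y (0, 1))" by simp
    also have "\<dots> = scale_pair (\<sigma> x) (a, c) + scale_pair (\<sigma> y) (b, d)"
      by (simp only: add' \<sigma> ac bd)
    finally show ?thesis by simp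
  qed
  \<comment> \<open>Since \<open>\<sigma>\<close> is onto and commutes with powers, it is absorbed
    into the variable \<open>X\<close>.\<close>
  have "c * X + d * X ^ (q ^ s) =
      e * a ^ Q' * X ^ (q ^ s') + e * b ^ Q' * X ^ (q ^ (s + s'))" for X
  proof -
    obtain x where X: "X = \<sigma> x" using \<sigma>_bij by (metis bij_pointE)
    have "(x, x ^ Q) \<in> U_set f" by (simp add: U_set_def)
    then have "\<phi> (x, x ^ Q) \<in> F'.graph e" using e by blast
    then have "X * c + X ^ Q * d = e * (X * a + X ^ Q * b) ^ Q'"
      by (auto simp: \<phi>_eq F'.graph_def \<sigma>_power X)
    also have "(X * a + X ^ Q * b) ^ Q' = X ^ Q' * a ^ Q' + X ^ (Q * Q') * b ^ Q'"
      by (simp add: F'.power_add power_mult_distrib power_mult)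
    finally show ?thesis by (simp add: Q_def Q'_def power_add algebra_simps)
  qed
  then have "c = 0 \<and> d = 0" by (rule Frobenius_monomials_independent[OF card \<open>q > 1\<close> \<open>t > 0\<close> s])
  moreover obtain v where "\<phi> v = (0, 1)" using bij by (metis bij_pointE)
  ultimately show False using \<phi>_eq[of "fst v" "snd v"] by simp
qed

section \<open>Construction of isomorphisms in the two congruent cases\<close>

text \<open>For mutually inverse power maps the swap takes \<open>U_set f\<close> to
  \<open>U_set f'\<close>, commutes with scaling, inverts slopes and exchanges the axes.\<close>

lemma swap_mem_spread_of:
  fixes f f' :: "'a::{field,finite} poly"
  assumes "frobenius_power Q f" and "frobenius_power Q' f'"
    and inverse: "\<And>x :: 'a. x ^ (Q * Q') = x" and V: "V \<in> spread_of f"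
  shows "prod.swap ` V \<in> spread_of f'"
proof -
  interpret F: frobenius_power Q f by fact
  interpret F': frobenius_power Q' f' by fact
  have inv1: "(x ^ Q) ^ Q' = x" and inv2: "(x ^ Q') ^ Q = x" for x :: 'a
    using inverse[of x] by (simp_all add: mult.commute flip: power_mult)
  \<comment> \<open>The vertical axis is swapped to slope 0, which must therefore be
    admissible.\<close>
  have zero: "0 \<notin> L_set f'" by (auto simp: F'.L_set_eq)
  have swap_line: "prod.swap ` line (x, y) = line (y, x)" for x y :: 'a
    by (simp add: line_def image_image)
  have line_scale: "line (m, 1) = line (1, 1 / m)" if m: "m \<noteq> 0" for m :: 'a
  proof (intro equalityI subsetI)
    fix v assume "v \<in> line (m, 1)"
    then obtain c where "v = scale_pair c (m, 1)" by (auto simp: line_def)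
    then have "v = scale_pair (c * m) (1, 1 / m)" using m by simp
    then show "v \<in> line (1, 1 / m)" unfolding line_def by (rule range_eqI)
  next
    fix v assume "v \<in> line (1, 1 / m)"
    then obtain c where "v = scale_pair c (1, 1 / m)" by (auto simp: line_def)
    then have "v = scale_pair (c / m) (m, 1)" using m by simp
    then show "v \<in> line (m, 1)" unfolding line_def by (rule range_eqI)
  qed
  have swap_U: "prod.swap ` U_set f = U_set f'"
  proof (intro equalityI subsetI)
    fix v assume "v \<in> prod.swap ` U_set f"
    then obtain x where "v = (x ^ Q, x)" by (auto simp: U_set_def)
    then have "v = (x ^ Q, poly f' (x ^ Q))" by (simp add: inv1)
    then show "v \<in> U_set f'" unfolding U_set_def by blast
  next
    fix v assume "v \<in> U_set f'"
    then obtain y where "v = (y, y ^ Q')" by (auto simp: U_set_def)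
    then have "v = prod.swap (y ^ Q', poly f (y ^ Q'))" by (simp add: inv2)
    then show "v \<in> prod.swap ` U_set f" unfolding U_set_def by blast
  qed
  show ?thesis using V
  proof (cases rule: F.mem_spread_ofE)
    case (1 m)
    show ?thesis
    proof (cases "m = 0")
      case True
      then show ?thesis using 1 by (simp add: swap_line F'.spread_of_eq)
    next
      case False
      have "1 / m \<notin> L_set f'"
      proof
        assume "1 / m \<in> L_set f'"
        then obtain y where y: "y \<noteq> 0" "1 / m = y ^ Q' / y" by (auto simp: F'.L_set_eq)
        \<comment> \<open>Here \<open>m = y / y ^ Q'\<close>, and \<open>y\<close> is the
          \<open>Q\<close>-th power of \<open>y ^ Q'\<close>.\<close>
        have "m = 1 / (1 / m)" by simp
        also have "\<dots> = (y ^ Q') ^ Q / y ^ Q'" unfolding y(2) inv2 by simp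
        finally have "m \<in> L_set f" unfolding F.L_set_eq using y(1) by force
        then show False using 1 by simp
      qed
      then show ?thesis using 1 False by (auto simp: swap_line line_scale F'.spread_of_eq)
    qed
  next
    case (2 c)
    then obtain h where h: "h \<noteq> 0" "V = scale_pair h ` U_set f"
      using F.scale_U_set F.mem_L_set_iff by auto
    have "prod.swap ` V = scale_pair h ` prod.swap ` U_set f"
      unfolding h(2) image_image by (simp add: scale_pair_def prod.swap_def)
    then show ?thesis using h(1) unfolding swap_U spread_of_def by auto
  next
    case 3
    then show ?thesis using zero by (auto simp: swap_line F'.spread_of_eq)
  qed
qed

lemma isomorphic_translation_planes_refl:
  "isomorphic_planes (translation_plane \<B>) (translation_plane \<B>)"
proof -
  have "points (translation_plane \<B>) = UNIV" by (simp add: translation_plane_def)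
  then show ?thesis unfolding isomorphic_planes_def by (intro exI[of _ id]) simp
qed

lemma isomorphic_planes_swap:
  fixes \<B> \<B>' :: "('a::ab_group_add \<times> 'a) set set"
  assumes "\<And>V. V \<in> \<B> \<Longrightarrow> prod.swap ` V \<in> \<B>'" and "\<And>V. V \<in> \<B>' \<Longrightarrow> prod.swap ` V \<in> \<B>"
  shows "isomorphic_planes (translation_plane \<B>) (translation_plane \<B>')"
proof -
  \<comment> \<open>Stated for arbitrary spreads so as to serve both directions, the swap being its
    own inverse.\<close>
  have swap_line: "prod.swap ` l \<in> lines (translation_plane \<C>')"
    if l: "l \<in> lines (translation_plane \<C>)" and \<C>: "\<And>V. V \<in> \<C> \<Longrightarrow> prod.swap ` V \<in> \<C>'"
    for l and \<C> \<C>' :: "('a \<times> 'a) set set"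
  proof -
    obtain V w where V: "V \<in> \<C>" and "l = (\<lambda>v. v + w) ` V"
      using l unfolding translation_plane_def by auto
    then have "prod.swap ` l = (\<lambda>v. v + prod.swap w) ` prod.swap ` V"
      by (auto simp: image_image prod.swap_def plus_prod_def)
    then show ?thesis using \<C>[OF V] unfolding translation_plane_def snd_conv by blast
  qed
  have "inv (prod.swap :: 'a \<times> 'a \<Rightarrow> _) = prod.swap" by (rule inv_equality) auto
  then show ?thesis
    unfolding isomorphic_planes_def
    using swap_line assms by (intro exI[of _ prod.swap]) (auto simp: translation_plane_def)
qed

theorem theorem4p7:
  fixes q t s s' :: nat and f f' :: "'a::{field,finite} poly"
  assumes "primepow q" and "q > 3" and "t > 1"
    and "CARD('a) = q ^ t"
    and "s > 0" and "s' > 0"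
    and "gcd s t = 1" and "gcd s' t = 1"
    and "f = monom 1 (q ^ s)" and "f' = monom 1 (q ^ s')"
  shows "isomorphic_planes (plane_of f) (plane_of f') \<longleftrightarrow>
         [int s = int s'] (mod int t) \<or> [int s = - int s'] (mod int t)"
proof -
  have cong1: "[int s = int s'] (mod int t) \<longleftrightarrow> s mod t = s' mod t"
    by (simp only: cong_int_iff) (simp add: cong_def)
  have cong2: "[int s = - int s'] (mod int t) \<longleftrightarrow> (s + s') mod t = 0"
  proof -
    have "[int s = - int s'] (mod int t) \<longleftrightarrow> int t dvd int (s + s')"
      by (simp add: cong_iff_dvd_diff)
    then show ?thesis unfolding int_dvd_int_iff by (simp add: dvd_eq_mod_eq_0)
  qed
  \<comment> \<open>A multiple of \<open>t\<close> is coprime to \<open>t\<close> only for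
    \<open>t = 1\<close>.\<close>
  have s: "s mod t \<noteq> 0" "s' mod t \<noteq> 0"
    using assms(3,7,8) gcd_nat.absorb2[of t s] gcd_nat.absorb2[of t s']
    by (auto simp: mod_greater_zero_iff_not_dvd)
  have frob: "frobenius_power (q ^ s) f" "frobenius_power (q ^ s') f'"
    using frobenius_power_monom[OF assms(1,4)] assms(9,10) by auto
  have "isomorphic_planes (plane_of f) (plane_of f')" if "s mod t = s' mod t"
  proof -
    \<comment> \<open>The polynomials may differ, but the plane depends only on the induced
      function.\<close>
    have "poly f x = poly f' x" for x
      using that Frobenius_power_mod[OF assms(4), of x s] Frobenius_power_mod[OF assms(4), of x s']
      unfolding assms(9,10) by (simp add: poly_monom)
    then have "plane_of f = plane_of f'"
      by (simp add: plane_of_def spread_of_def U_set_def L_set_def)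
    then show ?thesis using isomorphic_translation_planes_refl by (simp add: plane_of_def)
  qed
  moreover have "isomorphic_planes (plane_of f) (plane_of f')" if "(s + s') mod t = 0"
  proof -
    have "x ^ (q ^ s * q ^ s') = x" for x :: 'a
      using Frobenius_power_mod[OF assms(4), of x "s + s'"] that by (simp add: power_add)
    then show ?thesis unfolding plane_of_def
      using swap_mem_spread_of[OF frob] swap_mem_spread_of[OF frob(2,1)]
      by (intro isomorphic_planes_swap) (auto simp: mult.commute)
  qed
  ultimately show ?thesis unfolding cong1 cong2
    using not_isomorphic_planes_of[OF assms(1-4) s _ _ assms(9,10)] by metis
qed

end
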